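(* For every integer $k\geq 1$ and every graph $H$, there is a graph $G$ such that for every connected partition $\mathcal{P}$ of $G$, either some part of $\mathcal{P}$ contains $K_k$ or the quotient $G/\mathcal{P}$ contains $H$.
   Context: All graphs are finite, simple and undirected. A graph $G$ contains a graph $H$ if $H$ is isomorphic to an induced subgraph of $G$. A partition of a graph $G$ is a set $\mathcal{P}$ of non-empty induced subgraphs of $G$ such that each vertex of $G$ is in exactly one element of $\mathcal{P}$; each element of $\mathcal{P}$ is called a part. The quotient $G/\mathcal{P}$ is the graph with vertex set $\mathcal{P}$ in which distinct parts $P,Q\in\mathcal{P}$ are adjacent if and only if some vertex in $P$ is adjacent in $G$ to some vertex in $Q$. A partition is connected if each part is a connected graph. $K_n$ denotes the complete graph on $n$ vertices. "Either ... or" is inclusive. *)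

theory Defs
  imports "Graph_Theory.Graph_Theory"
begin

text \<open>
  Finite simple undirected graphs are rendered by the locale predicate \<^const>\<open>pair_graph\<close>: finite
  vertex set, and a symmetric irreflexive set of ordered pairs of vertices as edge relation. The
  null graph is included.
\<close>

definition complete_graph :: "nat \<Rightarrow> nat pair_pre_digraph" where
  "complete_graph n =
     \<lparr> pverts = {..<n}, parcs = {(i, j). i < n \<and> j < n \<and> i \<noteq> j} \<rparr>"

definition contains_graph :: "'a pair_pre_digraph \<Rightarrow> 'b pair_pre_digraph \<Rightarrow> bool" where
  "contains_graph G H \<longleftrightarrow>
     (\<exists>S :: 'a pair_pre_digraph. induced_subgraph (with_proj S) (with_proj G) \<and> digraph_iso (with_proj H) (with_proj S))"

definition graph_partition :: "'a pair_pre_digraph \<Rightarrow> 'a pair_pre_digraph set \<Rightarrow> bool" where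
  "graph_partition G \<P> \<longleftrightarrow>
     (\<forall>Q\<in>\<P>. induced_subgraph (with_proj Q) (with_proj G) \<and> pverts Q \<noteq> {}) \<and>
     (\<forall>v\<in>pverts G. \<exists>!Q. Q \<in> \<P> \<and> v \<in> pverts Q)"

definition connected_graph_partition ::
    "'a pair_pre_digraph \<Rightarrow> 'a pair_pre_digraph set \<Rightarrow> bool" where
  "connected_graph_partition G \<P> \<longleftrightarrow> graph_partition G \<P> \<and> (\<forall>Q\<in>\<P>. connected (with_proj Q))"

definition quotient_graph ::
    "'a pair_pre_digraph \<Rightarrow> 'a pair_pre_digraph set \<Rightarrow> 'a pair_pre_digraph pair_pre_digraph" where
  "quotient_graph G \<P> =
     \<lparr> pverts = \<P>,
       parcs = {(P, Q). P \<in> \<P> \<and> Q \<in> \<P> \<and> P \<noteq> Q \<and>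
                  (\<exists>u\<in>pverts P. \<exists>v\<in>pverts Q. (u, v) \<in> parcs G)} \<rparr>"

lemma complete_digraph_complete_graph: "complete_digraph n (complete_graph n)"
  by (auto simp: complete_digraph_pair_def complete_graph_def)

lemma induced_subgraph_pair_iff:
  fixes S G :: "'a pair_pre_digraph"
  assumes "pair_graph G"
  shows "induced_subgraph S G \<longleftrightarrow>
    pverts S \<subseteq> pverts G \<and> parcs S = parcs G \<inter> pverts S \<times> pverts S"
proof -
  interpret pair_graph G by fact
  have arcs: "{e \<in> parcs G. fst e \<in> pverts S \<and> snd e \<in> pverts S} = parcs G \<inter> pverts S \<times> pverts S"
    by (simp add: Int_def mem_Times_iff)
  have G: "wf_digraph (with_proj G)" by (rule wf_digraph)
  show ?thesis
  proof
    assume "induced_subgraph S G"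
    then show "pverts S \<subseteq> pverts G \<and> parcs S = parcs G \<inter> pverts S \<times> pverts S"
      by (simp add: induced_subgraph_def subgraph_def arcs)
  next
    assume S: "pverts S \<subseteq> pverts G \<and> parcs S = parcs G \<inter> pverts S \<times> pverts S"
    then have "wf_digraph (with_proj S)"
      by (simp add: wf_digraph_def mem_Times_iff)
    with S G show "induced_subgraph S G"
      by (simp add: induced_subgraph_def subgraph_def compatible_def arcs)
  qed
qed

lemma digraph_iso_pair_iff:
  fixes H :: "'a pair_pre_digraph" and S :: "'b pair_pre_digraph"
  assumes "pair_graph H"
  shows "digraph_iso H S \<longleftrightarrow>
    (\<exists>f. inj_on f (pverts H) \<and> pverts S = f ` pverts H \<and> parcs S = map_prod f f ` parcs H)"
proof
  assume "digraph_iso H S"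
  then obtain h where h: "pre_digraph.digraph_isomorphism (with_proj H) h"
    and S: "with_proj S = app_iso h (with_proj H)"
    by (auto simp: digraph_iso_def)
  have v: "pverts S = iso_verts h ` pverts H" and a: "parcs S = iso_arcs h ` parcs H"
    and t: "iso_tail h = fst" "iso_head h = snd"
    using S by (simp_all add: with_proj_def app_iso_def)
  have "iso_arcs h e = map_prod (iso_verts h) (iso_verts h) e" if "e \<in> parcs H" for e
    using h that t by (auto simp: pre_digraph.digraph_isomorphism_def prod_eq_iff)
  then have "parcs S = map_prod (iso_verts h) (iso_verts h) ` parcs H"
    unfolding a by (rule image_cong[OF refl])
  with v h show "\<exists>f. inj_on f (pverts H) \<and> pverts S = f ` pverts H
      \<and> parcs S = map_prod f f ` parcs H"
    by (auto simp: pre_digraph.digraph_isomorphism_def)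
next
  interpret pair_graph H by fact
  assume "\<exists>f. inj_on f (pverts H) \<and> pverts S = f ` pverts H
      \<and> parcs S = map_prod f f ` parcs H"
  then obtain f where f: "inj_on f (pverts H)" "pverts S = f ` pverts H"
    "parcs S = map_prod f f ` parcs H" by auto
  let ?h = "\<lparr> iso_verts = f, iso_arcs = map_prod f f, iso_head = snd, iso_tail = fst \<rparr>"
  have "wf_digraph (with_proj H)" by (rule wf_digraph)
  moreover have "inj_on (map_prod f f) (parcs H)"
  proof (rule inj_on_subset)
    show "inj_on (map_prod f f) (pverts H \<times> pverts H)"
      using f(1) f(1) by (rule map_prod_inj_on)
    show "parcs H \<subseteq> pverts H \<times> pverts H"
      using in_arcsD1 in_arcsD2 by auto
  qed
  ultimately have "pre_digraph.digraph_isomorphism (with_proj H) ?h"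
    using f(1) by (auto simp: pre_digraph.digraph_isomorphism_def)
  moreover have "with_proj S = app_iso ?h (with_proj H)"
    using f by (simp add: with_proj_def app_iso_def)
  ultimately show "digraph_iso H S" by (auto simp: digraph_iso_def)
qed

lemma pair_graph_quotient_graph:
  assumes "pair_graph G" "graph_partition G \<P>"
  shows "pair_graph (quotient_graph G \<P>)"
proof -
  interpret pair_graph G by fact
  have "inj_on pverts \<P>"
  proof (rule inj_onI)
    fix P Q assume PQ: "P \<in> \<P>" "Q \<in> \<P>" "pverts P = pverts Q"
    then have "parcs P = parcs Q"
      using assms(2) by (simp add: graph_partition_def induced_subgraph_pair_iff[OF assms(1)])
    with PQ show "P = Q" by simp
  qed
  moreover have "pverts ` \<P> \<subseteq> Pow (pverts G)"
    using assms(2) by (auto simp: graph_partition_def induced_subgraph_pair_iff[OF assms(1)])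
  ultimately have fin: "finite \<P>"
    using pair_finite_verts by (meson finite_Pow_iff finite_subset inj_on_finite)
  have sub: "parcs (quotient_graph G \<P>) \<subseteq> \<P> \<times> \<P>"
    by (auto simp: quotient_graph_def)
  have sym: "(v, u) \<in> parcs G" if "(u, v) \<in> parcs G" for u v
    using that by (rule arcs_symmetric)
  show ?thesis
  proof
    show "finite (parcs (quotient_graph G \<P>))"
      using sub fin by (meson finite_SigmaI finite_subset)
    show "symmetric (with_proj (quotient_graph G \<P>))"
      by (auto simp: symmetric_def sym_def quotient_graph_def intro: sym)
  qed (use fin in \<open>auto simp: quotient_graph_def\<close>)
qed

end

theory Submission
  imports Defs "HOL-Library.Nat_Bijection"
begin

text \<open>
  A connected partition is handled as a colouring \<open>p\<close> of the vertices by natural numbers whose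
  colour classes are connected; its quotient is the graph \<open>colour_adj\<close> on the colours. Restricting a
  partition to a subgraph is then restricting the colouring, and only the connectedness of the
  restricted classes has to be checked. A graph \<open>G\<close> is \<open>unavoidable k H\<close> when every such colouring
  has a monochromatic \<open>K\<^sub>k\<close> or an induced copy of \<open>H\<close> among its colours.

  Such a \<open>G\<close> is built by induction on \<open>k\<close>, and for fixed \<open>k\<close> by induction on the number of vertices
  of \<open>H\<close>. To pass from \<open>k\<close> to \<open>k + 1\<close>, pick a vertex \<open>v\<close> of \<open>H\<close>, let \<open>W\<close> be the graph for \<open>k + 1\<close> and
  \<open>H - v\<close>, and let \<open>F\<close> be the graph for \<open>k\<close> and \<open>H\<close>. In \<open>W\<close> we find colours forming \<open>H - v\<close>; what is
  missing is one more colour, adjacent to exactly the prescribed colours of \<open>W\<close>.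

  The source of such a colour is a clique \<open>C\<close> of size \<open>k\<close> contained in one colour class \<open>Q\<close>: if no
  monochromatic \<open>K\<^bsub>k+1\<^esub>\<close> exists, then no vertex joined to all of \<open>C\<close> has the colour of \<open>Q\<close>. So let
  \<open>X\<close> be a graph with a set \<open>M\<close> of marked vertices, and attach to each \<open>k\<close>-clique of \<open>F\<close> its own copy
  of \<open>X\<close>, the clique being joined to all marked vertices of the copy. Cutting off graphs that are
  attached to cliques leaves connected classes connected and colours adjacent as before, so \<open>F\<close> with
  the restricted colouring contains either \<open>H\<close> in the quotient, and we are done, or a monochromatic
  \<open>k\<close>-clique \<open>C\<close>. In the second case \<open>Q\<close> cannot enter the copy of \<open>X\<close> at \<open>C\<close>, every class
  meeting this copy is confined to it, and \<open>Q\<close> is adjacent to precisely those of its classes that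
  contain a marked vertex (lemmas \<open>copy_saturated\<close> and \<open>clique_colour_adj_iff\<close>).

  Since \<open>W\<close> is finite, this can be iterated over all vertex sets \<open>S\<close> of \<open>W\<close>, starting with \<open>W\<close>
  and marking in the round of \<open>S\<close> the vertices of \<open>S\<close> in all copies of \<open>W\<close>. In the resulting graph some
  copy of \<open>W\<close> is a union of classes, and every \<open>S\<close> has a colour outside this copy that is adjacent to
  exactly the colours of the copy occurring on \<open>S\<close>. The colouring of this copy yields \<open>H - v\<close>, and
  choosing \<open>S\<close> as the union of the classes that represent neighbours of \<open>v\<close> completes it to \<open>H\<close>.
\<close>

section \<open>Colourings with connected classes\<close>

text \<open>
  Connectedness as the absence of empty cuts. The empty set counts as connected, so that unused
  colours impose no condition.
\<close>

definition connected_in :: "('v \<times> 'v) set \<Rightarrow> 'v set \<Rightarrow> bool" where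
  "connected_in E A \<longleftrightarrow> (\<forall>B. B \<noteq> {} \<and> B \<subset> A \<longrightarrow> (\<exists>u\<in>B. \<exists>v\<in>A - B. (u, v) \<in> E))"

definition complete_on :: "('v \<times> 'v) set \<Rightarrow> 'v set \<Rightarrow> bool" where
  "complete_on E C \<longleftrightarrow> (\<forall>u\<in>C. \<forall>v\<in>C. u \<noteq> v \<longrightarrow> (u, v) \<in> E)"

definition connected_colouring :: "'v pair_pre_digraph \<Rightarrow> ('v \<Rightarrow> nat) \<Rightarrow> bool" where
  "connected_colouring G p \<longleftrightarrow> (\<forall>q. connected_in (parcs G) {v \<in> pverts G. p v = q})"

definition mono_clique :: "nat \<Rightarrow> 'v pair_pre_digraph \<Rightarrow> ('v \<Rightarrow> nat) \<Rightarrow> bool" where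
  "mono_clique k G p \<longleftrightarrow>
     (\<exists>C q. C \<subseteq> pverts G \<and> complete_on (parcs G) C \<and> card C = k \<and> (\<forall>u\<in>C. p u = q))"

definition colour_adj :: "'v pair_pre_digraph \<Rightarrow> ('v \<Rightarrow> nat) \<Rightarrow> nat \<Rightarrow> nat \<Rightarrow> bool" where
  "colour_adj G p a b \<longleftrightarrow> a \<noteq> b \<and> (\<exists>(u, v)\<in>parcs G. p u = a \<and> p v = b)"

definition quotient_copy ::
    "'h pair_pre_digraph \<Rightarrow> 'v pair_pre_digraph \<Rightarrow> ('v \<Rightarrow> nat) \<Rightarrow> ('h \<Rightarrow> nat) \<Rightarrow> bool" where
  "quotient_copy H G p f \<longleftrightarrow>
     inj_on f (pverts H) \<and> f ` pverts H \<subseteq> p ` pverts G \<and>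
     (\<forall>x\<in>pverts H. \<forall>y\<in>pverts H. (x, y) \<in> parcs H \<longleftrightarrow> colour_adj G p (f x) (f y))"

definition unavoidable :: "nat \<Rightarrow> 'h pair_pre_digraph \<Rightarrow> 'v pair_pre_digraph \<Rightarrow> bool" where
  "unavoidable k H G \<longleftrightarrow>
     (\<forall>p. connected_colouring G p \<longrightarrow> mono_clique k G p \<or> (\<exists>f. quotient_copy H G p f))"

definition induced_embedding ::
    "('w \<Rightarrow> 'v) \<Rightarrow> 'w pair_pre_digraph \<Rightarrow> 'v pair_pre_digraph \<Rightarrow> bool" where
  "induced_embedding \<phi> W G \<longleftrightarrow>
     inj_on \<phi> (pverts W) \<and> \<phi> ` pverts W \<subseteq> pverts G \<and>
     (\<forall>u\<in>pverts W. \<forall>v\<in>pverts W. (\<phi> u, \<phi> v) \<in> parcs G \<longleftrightarrow> (u, v) \<in> parcs W)"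

text \<open>
  The copy of \<open>W\<close> is a union of colour classes. Hence the colouring of the whole graph and the
  colouring of the copy have the same classes and the same adjacencies on the colours of the copy.
\<close>

definition saturated ::
    "('v \<Rightarrow> nat) \<Rightarrow> ('w \<Rightarrow> 'v) \<Rightarrow> 'w pair_pre_digraph \<Rightarrow> 'v pair_pre_digraph \<Rightarrow> bool" where
  "saturated p \<phi> W G \<longleftrightarrow>
     (\<forall>y\<in>pverts G. p y \<in> p ` \<phi> ` pverts W \<longrightarrow> y \<in> \<phi> ` pverts W)"

lemma pair_graph_arcs:
  assumes "pair_graph G" "(u, v) \<in> parcs G"
  shows "u \<in> pverts G" "v \<in> pverts G" "u \<noteq> v" "(v, u) \<in> parcs G"
proof -
  interpret pair_graph G by fact
  show "u \<in> pverts G" "v \<in> pverts G" using assms(2) in_arcsD1 in_arcsD2 by auto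
  show "u \<noteq> v" using assms(2) no_loops' by blast
  show "(v, u) \<in> parcs G" using assms(2) by (rule arcs_symmetric)
qed

lemma finite_pverts:
  assumes "pair_graph G"
  shows "finite (pverts G)"
proof -
  interpret pair_graph G by fact
  show ?thesis by (rule pair_finite_verts)
qed

lemma pair_graphI:
  assumes "finite (pverts G)" "\<And>u v. (u, v) \<in> parcs G \<Longrightarrow> u \<in> pverts G \<and> v \<in> pverts G \<and> u \<noteq> v"
    "\<And>u v. (u, v) \<in> parcs G \<Longrightarrow> (v, u) \<in> parcs G"
  shows "pair_graph G"
proof
  have "parcs G \<subseteq> pverts G \<times> pverts G" using assms(2) by auto
  then show "finite (parcs G)" using assms(1) by (meson finite_SigmaI finite_subset)
  show "symmetric (with_proj G)"
    using assms(3) by (auto simp: symmetric_def sym_def)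
qed (use assms(1,2) in auto)

lemma connected_inD:
  assumes "connected_in E A" "B \<noteq> {}" "B \<subset> A"
  obtains u v where "u \<in> B" "v \<in> A" "v \<notin> B" "(u, v) \<in> E"
  using assms unfolding connected_in_def by blast

lemma connected_in_mono:
  assumes "connected_in E A" "E \<subseteq> E'"
  shows "connected_in E' A"
  unfolding connected_in_def
proof (intro allI impI, elim conjE)
  fix B assume "B \<noteq> {}" "B \<subset> A"
  with assms(1) obtain u v where "u \<in> B" "v \<in> A" "v \<notin> B" "(u, v) \<in> E"
    by (rule connected_inD)
  then show "\<exists>u\<in>B. \<exists>v\<in>A - B. (u, v) \<in> E'" using assms(2) by blast
qed

lemma colour_adj_sym:
  assumes "pair_graph G"
  shows "colour_adj G p a b \<longleftrightarrow> colour_adj G p b a"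
  unfolding colour_adj_def using pair_graph_arcs(4)[OF assms] by blast

lemma colour_adj_embedding:
  assumes "pair_graph W" "induced_embedding \<phi> W G" "colour_adj W (p \<circ> \<phi>) a b"
  shows "colour_adj G p a b"
proof -
  from assms(3) obtain u v where uv: "a \<noteq> b" "(u, v) \<in> parcs W" "p (\<phi> u) = a" "p (\<phi> v) = b"
    by (auto simp: colour_adj_def)
  then have "(\<phi> u, \<phi> v) \<in> parcs G"
    using assms(2) pair_graph_arcs[OF assms(1)] by (auto simp: induced_embedding_def)
  with uv show ?thesis by (auto simp: colour_adj_def)
qed

text \<open>
  A copy of \<open>H\<close> in the quotient of a subgraph survives in the quotient of the whole graph as soon as
  the rest of the graph creates no new adjacencies between colours of the subgraph.
\<close>

lemma quotient_copy_embedding: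
  assumes W: "pair_graph W" and \<phi>: "induced_embedding \<phi> W G"
    and adj: "\<And>a b. a \<in> p ` \<phi> ` pverts W \<Longrightarrow> b \<in> p ` \<phi> ` pverts W \<Longrightarrow> colour_adj G p a b
                \<Longrightarrow> colour_adj W (p \<circ> \<phi>) a b"
    and f: "quotient_copy H W (p \<circ> \<phi>) f"
  shows "quotient_copy H G p f"
proof -
  have im: "f ` pverts H \<subseteq> p ` \<phi> ` pverts W"
    using f by (simp add: quotient_copy_def image_comp)
  have "colour_adj G p (f x) (f y) \<longleftrightarrow> colour_adj W (p \<circ> \<phi>) (f x) (f y)"
    if "x \<in> pverts H" "y \<in> pverts H" for x y
  proof
    have "f x \<in> p ` \<phi> ` pverts W" "f y \<in> p ` \<phi> ` pverts W" using im that by auto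
    then show "colour_adj G p (f x) (f y) \<Longrightarrow> colour_adj W (p \<circ> \<phi>) (f x) (f y)" by (rule adj)
  qed (rule colour_adj_embedding[OF W \<phi>])
  moreover have "f ` pverts H \<subseteq> p ` pverts G"
    by (rule order_trans[OF im image_mono]) (use \<phi> in \<open>simp add: induced_embedding_def\<close>)
  ultimately show ?thesis using f by (simp add: quotient_copy_def)
qed

lemma mono_clique_embedding:
  assumes \<phi>: "induced_embedding \<phi> W G" and "mono_clique k W (p \<circ> \<phi>)"
  shows "mono_clique k G p"
proof -
  from assms(2) obtain C q where C: "C \<subseteq> pverts W" "complete_on (parcs W) C" "card C = k"
    "\<forall>u\<in>C. p (\<phi> u) = q"
    by (auto simp: mono_clique_def)
  have "inj_on \<phi> C" using \<phi> C(1) by (auto simp: induced_embedding_def intro: inj_on_subset)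
  then have "card (\<phi> ` C) = k" using C(3) by (simp add: card_image)
  moreover have "\<phi> ` C \<subseteq> pverts G" "complete_on (parcs G) (\<phi> ` C)"
    using \<phi> C(1,2) by (auto simp: induced_embedding_def complete_on_def subset_iff)
  ultimately show ?thesis using C(4) unfolding mono_clique_def by (intro exI[of _ "\<phi> ` C"]) auto
qed

lemma saturated_colour_adj:
  assumes G: "pair_graph G" and \<phi>: "induced_embedding \<phi> W G" and sat: "saturated p \<phi> W G"
    and ab: "a \<in> p ` \<phi> ` pverts W" "b \<in> p ` \<phi> ` pverts W" and adj: "colour_adj G p a b"
  shows "colour_adj W (p \<circ> \<phi>) a b"
proof -
  from adj obtain u v where uv: "a \<noteq> b" "(u, v) \<in> parcs G" "p u = a" "p v = b"
    by (auto simp: colour_adj_def)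
  then have "u \<in> \<phi> ` pverts W" "v \<in> \<phi> ` pverts W"
    using sat ab pair_graph_arcs[OF G uv(2)] by (auto simp: saturated_def)
  then show ?thesis using uv \<phi> by (fastforce simp: colour_adj_def induced_embedding_def)
qed

lemma saturated_connected_colouring:
  assumes \<phi>: "induced_embedding \<phi> W G" and sat: "saturated p \<phi> W G"
    and p: "connected_colouring G p"
  shows "connected_colouring W (p \<circ> \<phi>)"
  unfolding connected_colouring_def connected_in_def
proof (intro allI impI, elim conjE)
  fix q B
  let ?A = "{v \<in> pverts W. (p \<circ> \<phi>) v = q}"
  assume B: "B \<noteq> {}" "B \<subset> ?A"
  have fib: "{v \<in> pverts G. p v = q} = \<phi> ` ?A"
    using B \<phi> sat by (fastforce simp: induced_embedding_def saturated_def)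
  have inj: "inj_on \<phi> (pverts W)" using \<phi> by (simp add: induced_embedding_def)
  have sub: "\<phi> ` B \<subset> \<phi> ` ?A"
    using inj_on_image_eq_iff[OF inj, of B ?A] B by (intro psubsetI image_mono) auto
  have "connected_in (parcs G) (\<phi> ` ?A)"
    using p unfolding connected_colouring_def fib[symmetric] by blast
  then obtain u v where "u \<in> \<phi> ` B" "v \<in> \<phi> ` ?A" "v \<notin> \<phi> ` B" "(u, v) \<in> parcs G"
    by (rule connected_inD[OF _ _ sub]) (use B(1) in auto)
  then obtain u' v' where "u' \<in> B" "v' \<in> ?A - B" "(\<phi> u', \<phi> v') \<in> parcs G" by blast
  moreover have "u' \<in> pverts W" "v' \<in> pverts W" using calculation B(2) by auto
  ultimately show "\<exists>u\<in>B. \<exists>v\<in>?A - B. (u, v) \<in> parcs W"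
    using \<phi> by (auto simp: induced_embedding_def)
qed

lemma induced_embedding_comp:
  assumes "induced_embedding \<phi> W X" "induced_embedding \<psi> X G"
  shows "induced_embedding (\<psi> \<circ> \<phi>) W G"
proof -
  have "inj_on \<psi> (\<phi> ` pverts W)"
    using assms by (meson induced_embedding_def inj_on_subset)
  then have "inj_on (\<psi> \<circ> \<phi>) (pverts W)"
    using assms(1) by (simp add: induced_embedding_def comp_inj_on)
  then show ?thesis
    using assms by (simp add: induced_embedding_def image_subset_iff)
qed

lemma saturated_comp:
  assumes "induced_embedding \<phi> W X" "saturated (p \<circ> \<psi>) \<phi> W X" "saturated p \<psi> X G"
  shows "saturated p (\<psi> \<circ> \<phi>) W G"
  unfolding saturated_def
proof (intro ballI impI)
  fix y assume y: "y \<in> pverts G" "p y \<in> p ` (\<psi> \<circ> \<phi>) ` pverts W"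
  then have "p y \<in> p ` \<psi> ` pverts X" using assms(1) by (auto simp: induced_embedding_def)
  then obtain x where x: "x \<in> pverts X" "y = \<psi> x" using y(1) assms(3) by (auto simp: saturated_def)
  then have "x \<in> \<phi> ` pverts W"
    using y(2) assms(2) by (auto simp: saturated_def image_comp o_assoc)
  with x show "y \<in> (\<psi> \<circ> \<phi>) ` pverts W" by auto
qed

section \<open>Attaching copies of a graph to cliques\<close>

text \<open>
  Vertices of the composite graph stay natural numbers, so that the construction can be iterated
  within one type: tag \<open>0\<close> marks the vertices of \<open>F\<close>, tag \<open>Suc i\<close> those of the \<open>i\<close>-th copy of \<open>X\<close>.
\<close>

definition base :: "nat \<Rightarrow> nat" where "base f = prod_encode (0, f)"
definition copy :: "nat \<Rightarrow> nat \<Rightarrow> nat" where "copy i x = prod_encode (Suc i, x)"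

lemma base_copy_simps [simp]:
  "base f = base g \<longleftrightarrow> f = g" "base f \<noteq> copy i x" "copy i x \<noteq> base f"
  "copy i x = copy j y \<longleftrightarrow> i = j \<and> x = y"
  by (simp_all add: base_def copy_def)

locale clique_attachment =
  fixes F X :: "nat pair_pre_digraph" and M I :: "nat set" and c :: "nat \<Rightarrow> nat set"
  assumes F: "pair_graph F" and X: "pair_graph X" and M: "M \<subseteq> pverts X" and I: "finite I"
    and c: "\<And>i. i \<in> I \<Longrightarrow> c i \<subseteq> pverts F" "\<And>i. i \<in> I \<Longrightarrow> complete_on (parcs F) (c i)"
begin

text \<open>
  The graph \<open>F\<close> with one copy of \<open>X\<close> for each index \<open>i\<close>, where the clique \<open>c i\<close> of \<open>F\<close> is completely
  joined to the marked vertices of the \<open>i\<close>-th copy.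
\<close>

definition Y :: "nat pair_pre_digraph" where
  "Y = \<lparr> pverts = base ` pverts F \<union> (\<Union>i\<in>I. copy i ` pverts X),
         parcs = {(base f, base g) | f g. (f, g) \<in> parcs F}
               \<union> {(copy i x, copy i y) | i x y. i \<in> I \<and> (x, y) \<in> parcs X}
               \<union> {(base f, copy i x) | i f x. i \<in> I \<and> f \<in> c i \<and> x \<in> M}
               \<union> {(copy i x, base f) | i f x. i \<in> I \<and> f \<in> c i \<and> x \<in> M} \<rparr>"

lemma Y_verts [simp]:
  "base f \<in> pverts Y \<longleftrightarrow> f \<in> pverts F"
  "copy i x \<in> pverts Y \<longleftrightarrow> i \<in> I \<and> x \<in> pverts X"
  by (auto simp: Y_def)

lemma Y_arcs [simp]:
  "(base f, base g) \<in> parcs Y \<longleftrightarrow> (f, g) \<in> parcs F"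
  "(base f, copy i x) \<in> parcs Y \<longleftrightarrow> i \<in> I \<and> f \<in> c i \<and> x \<in> M"
  "(copy i x, base f) \<in> parcs Y \<longleftrightarrow> i \<in> I \<and> f \<in> c i \<and> x \<in> M"
  "(copy i x, copy j y) \<in> parcs Y \<longleftrightarrow> i = j \<and> i \<in> I \<and> (x, y) \<in> parcs X"
  by (auto simp: Y_def)

lemma Y_cases:
  assumes "v \<in> pverts Y"
  obtains (base) f where "v = base f" "f \<in> pverts F"
    | (copy) i x where "v = copy i x" "i \<in> I" "x \<in> pverts X"
  using assms by (auto simp: Y_def)

lemma pair_graph_Y: "pair_graph Y"
proof (rule pair_graphI)
  show "finite (pverts Y)"
    using I finite_pverts[OF F] finite_pverts[OF X] by (simp add: Y_def)
next
  fix u v assume "(u, v) \<in> parcs Y"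
  then show "u \<in> pverts Y \<and> v \<in> pverts Y \<and> u \<noteq> v"
    using c(1) M pair_graph_arcs(1-3)[OF F] pair_graph_arcs(1-3)[OF X]
    by (fastforce simp: Y_def)
next
  fix u v assume "(u, v) \<in> parcs Y"
  then show "(v, u) \<in> parcs Y"
    using pair_graph_arcs(4)[OF F] pair_graph_arcs(4)[OF X] unfolding Y_def by auto
qed

lemma base_embedding: "induced_embedding base F Y"
  by (auto simp: induced_embedding_def inj_on_def)

lemma copy_embedding: "i \<in> I \<Longrightarrow> induced_embedding (copy i) X Y"
  by (auto simp: induced_embedding_def inj_on_def)

lemma cross_arc:
  assumes "(copy i x, v) \<in> parcs Y" "v \<notin> copy i ` pverts X"
  obtains f where "v = base f" "f \<in> c i" "x \<in> M"
proof -
  have "v \<in> pverts Y" using pair_graph_arcs[OF pair_graph_Y assms(1)] by simp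
  then show thesis
    by (cases rule: Y_cases) (use assms that in auto)
qed

context
  fixes p :: "nat \<Rightarrow> nat"
  assumes p: "connected_colouring Y p"
begin

lemma cut:
  assumes "B \<noteq> {}" "B \<subset> {v \<in> pverts Y. p v = q}"
  obtains u v where "u \<in> B" "v \<in> pverts Y" "p v = q" "v \<notin> B" "(u, v) \<in> parcs Y"
proof -
  have "connected_in (parcs Y) {v \<in> pverts Y. p v = q}"
    using p by (simp add: connected_colouring_def)
  then show thesis using assms by (rule connected_inD) (use that in auto)
qed

text \<open>
  The only way out of a copy leads from a marked vertex to its clique, so a class that meets the copy
  and also something else has to use it.
\<close>

lemma class_meets_clique:
  assumes "i \<in> I" "x \<in> pverts X" "v \<in> pverts Y" "p v = p (copy i x)" "v \<notin> copy i ` pverts X"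
  obtains f y where "f \<in> c i" "p (base f) = p (copy i x)" "y \<in> M" "p (copy i y) = p (copy i x)"
proof -
  let ?B = "{u \<in> copy i ` pverts X. p u = p (copy i x)}"
  have "?B \<noteq> {}" "?B \<subset> {v \<in> pverts Y. p v = p (copy i x)}" using assms by auto
  then obtain u v where "u \<in> ?B" "p v = p (copy i x)" "v \<notin> ?B" "(u, v) \<in> parcs Y"
    by (rule cut)
  then show thesis using that by (auto elim!: cross_arc)
qed

text \<open>
  An empty cut of a class inside \<open>F\<close> would extend to an empty cut of the class in the whole graph:
  the part of the class in the \<open>i\<close>-th copy goes to the side containing the colour's vertices in
  \<open>c i\<close>, and these all lie on one side because \<open>c i\<close> is a clique.
\<close>

lemma base_connected: "connected_colouring F (p \<circ> base)"
  unfolding connected_colouring_def connected_in_def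
proof (intro allI impI, elim conjE)
  fix q B
  let ?A = "{v \<in> pverts F. (p \<circ> base) v = q}"
  assume B: "B \<noteq> {}" "B \<subset> ?A"
  show "\<exists>u\<in>B. \<exists>v\<in>?A - B. (u, v) \<in> parcs F"
  proof (rule ccontr)
    assume no: "\<not> ?thesis"
    define B' where "B' = base ` B \<union>
      {copy i x | i x. i \<in> I \<and> x \<in> pverts X \<and> p (copy i x) = q \<and> c i \<inter> B \<noteq> {}}"
    have base_B': "base f \<in> B' \<longleftrightarrow> f \<in> B" for f by (auto simp: B'_def)
    have copy_B': "copy i x \<in> B' \<longleftrightarrow> i \<in> I \<and> x \<in> pverts X \<and> p (copy i x) = q \<and> c i \<inter> B \<noteq> {}"
      for i x by (auto simp: B'_def)
    have "B' \<noteq> {}" using B by (auto simp: B'_def)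
    moreover have "B' \<subset> {v \<in> pverts Y. p v = q}"
    proof
      show "B' \<subseteq> {v \<in> pverts Y. p v = q}" using B by (auto simp: B'_def)
      obtain f where f: "f \<in> ?A" "f \<notin> B" using B by auto
      then have "base f \<in> {v \<in> pverts Y. p v = q}" "base f \<notin> B'" using base_B' by auto
      then show "B' \<noteq> {v \<in> pverts Y. p v = q}" by blast
    qed
    ultimately obtain u v where uv: "u \<in> B'" "v \<in> pverts Y" "p v = q" "v \<notin> B'" "(u, v) \<in> parcs Y"
      by (rule cut)
    from uv(2) show False
    proof (cases rule: Y_cases)
      case v: (base g)
      then have g: "g \<in> ?A - B" using uv base_B' by auto
      obtain f where f: "f \<in> B" "f \<noteq> g \<longrightarrow> (f, g) \<in> parcs F"
      proof (cases "u \<in> base ` B")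
        case True
        then show thesis using that uv(5) v by auto
      next
        case False
        then obtain i x where "u = copy i x" "i \<in> I" "c i \<inter> B \<noteq> {}" using uv(1) by (auto simp: B'_def)
        moreover have "g \<in> c i" using calculation uv(5) v by auto
        ultimately show thesis using that c(2) by (auto simp: complete_on_def)
      qed
      then show False using no g by auto
    next
      case v: (copy i x)
      then have "c i \<inter> B = {}" using uv(3,4) copy_B' by auto
      then show False using uv(1,5) v by (auto simp: B'_def)
    qed
  qed
qed

text \<open>
  Two classes that meet \<open>F\<close> and touch inside a copy both reach into the clique of that copy, where
  they touch as well.
\<close>

lemma base_colour_adj:
  assumes ab: "a \<in> p ` base ` pverts F" "b \<in> p ` base ` pverts F" and adj: "colour_adj Y p a b"
  shows "colour_adj F (p \<circ> base) a b"
proof -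
  from adj obtain u v where uv: "a \<noteq> b" "(u, v) \<in> parcs Y" "p u = a" "p v = b"
    by (auto simp: colour_adj_def)
  have meet: "\<exists>f\<in>c i. p (base f) = q"
    if "i \<in> I" "x \<in> pverts X" "p (copy i x) = q" "q \<in> p ` base ` pverts F" for i x q
  proof -
    from that(4) obtain g where "g \<in> pverts F" "p (base g) = q" by auto
    then have "base g \<in> pverts Y" "p (base g) = p (copy i x)" "base g \<notin> copy i ` pverts X"
      using that(3) by auto
    then show ?thesis using class_meets_clique[OF that(1,2)] that(3) by blast
  qed
  have join: ?thesis if "i \<in> I" "f \<in> c i" "p (base f) = a" "g \<in> c i" "p (base g) = b" for i f g
  proof -
    have "f \<noteq> g" using that uv(1) by auto
    then have "(f, g) \<in> parcs F" using c(2)[OF that(1)] that(2,4) by (simp add: complete_on_def)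
    then show ?thesis unfolding colour_adj_def using that(3,5) uv(1) by fastforce
  qed
  from uv(2) consider f g where "u = base f" "v = base g" "(f, g) \<in> parcs F"
    | i where "i \<in> I" "u \<in> base ` c i \<union> copy i ` pverts X" "v \<in> base ` c i \<union> copy i ` pverts X"
  proof -
    have M': "x \<in> M \<Longrightarrow> x \<in> pverts X" for x using M by auto
    from uv(2) show thesis
      unfolding Y_def using that pair_graph_arcs(1,2)[OF X] M' by auto
  qed
  then show ?thesis
  proof cases
    case 1
    then show ?thesis using uv by (auto simp: colour_adj_def)
  next
    case (2 i)
    have "\<exists>f\<in>c i. p (base f) = a"
      using 2(2) meet[OF 2(1) _ _ ab(1)] uv(3) by blast
    moreover have "\<exists>f\<in>c i. p (base f) = b"
      using 2(3) meet[OF 2(1) _ _ ab(2)] uv(4) by blast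
    ultimately show ?thesis using join[OF 2(1)] by blast
  qed
qed

text \<open>
  From here on the clique of copy \<open>i\<close> lies in the class of colour \<open>q\<close> and cannot be enlarged to a
  monochromatic clique.
\<close>

context
  fixes i q
  assumes i: "i \<in> I" and c_nonempty: "c i \<noteq> {}" and mono: "\<forall>f\<in>c i. p (base f) = q"
    and no_mono: "\<not> mono_clique (Suc (card (c i))) Y p"
begin

text \<open>
  To enter the copy, the class would need a marked vertex, and such a vertex is joined to the whole
  clique.
\<close>

lemma copy_avoids_colour:
  assumes "x \<in> pverts X"
  shows "p (copy i x) \<noteq> q"
proof
  assume q: "p (copy i x) = q"
  obtain g where g: "g \<in> c i" using c_nonempty by auto
  then have "base g \<in> pverts Y" "p (base g) = p (copy i x)" "base g \<notin> copy i ` pverts X"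
    using c(1) i bspec[OF mono g] g q by auto
  then obtain y where y: "y \<in> M" "p (copy i y) = q"
    using class_meets_clique[OF i assms] q by metis
  let ?C = "insert (copy i y) (base ` c i)"
  have fin: "finite (c i)"
    using c(1)[OF i] F by (meson finite_subset finite_pverts)
  have "card ?C = Suc (card (c i))"
    using fin by (subst card_insert_disjoint) (auto simp: card_image inj_on_def)
  moreover have "complete_on (parcs Y) ?C"
    using c(2)[OF i] i y(1) by (auto simp: complete_on_def)
  moreover have "?C \<subseteq> pverts Y" using c(1)[OF i] i y(1) M by auto
  ultimately have "mono_clique (Suc (card (c i))) Y p"
    unfolding mono_clique_def using y(2) mono by (intro exI[of _ ?C] exI[of _ q]) auto
  then show False using no_mono by simp
qed

lemma copy_saturated: "saturated p (copy i) X Y"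
  unfolding saturated_def
proof (intro ballI impI, rule ccontr)
  fix v assume v: "v \<in> pverts Y" "p v \<in> p ` copy i ` pverts X" "v \<notin> copy i ` pverts X"
  then obtain x where x: "x \<in> pverts X" "p v = p (copy i x)" by auto
  then obtain f where "f \<in> c i" "p (base f) = p (copy i x)"
    using class_meets_clique[OF i x(1) v(1) x(2) v(3)] by blast
  then show False using mono copy_avoids_colour x(1) by metis
qed

lemma clique_colour_adj_iff:
  assumes x: "x \<in> pverts X"
  shows "colour_adj Y p q (p (copy i x)) \<longleftrightarrow> (\<exists>y\<in>M. p (copy i y) = p (copy i x))"
proof
  assume "colour_adj Y p q (p (copy i x))"
  then obtain u v where uv: "(u, v) \<in> parcs Y" "p u = q" "p v = p (copy i x)"
    by (auto simp: colour_adj_def)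
  note arc = pair_graph_arcs[OF pair_graph_Y uv(1)]
  obtain y where y: "v = copy i y" "y \<in> pverts X"
    using copy_saturated uv(3) x arc(2) by (auto simp: saturated_def)
  have "u \<notin> copy i ` pverts X" using copy_avoids_colour uv(2) by auto
  then have "y \<in> M" using cross_arc arc(4) y(1) by metis
  then show "\<exists>y\<in>M. p (copy i y) = p (copy i x)" using y uv by auto
next
  assume "\<exists>y\<in>M. p (copy i y) = p (copy i x)"
  then obtain y where y: "y \<in> M" "p (copy i y) = p (copy i x)" by auto
  obtain f where f: "f \<in> c i" using c_nonempty by auto
  then have "(base f, copy i y) \<in> parcs Y" using i y(1) by auto
  then show "colour_adj Y p q (p (copy i x))"
    unfolding colour_adj_def using bspec[OF mono f] y(2) copy_avoids_colour[OF x] by force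
qed

end
end
end

section \<open>Supplying a colour for every vertex set\<close>

text \<open>
  The invariant of the iteration over the sets \<open>S\<close>. The map \<open>r\<close> remembers which vertex of \<open>W\<close> a vertex
  of \<open>X\<close> stands for, uniformly for all copies of \<open>W\<close> in \<open>X\<close>; this is needed since the copy \<open>\<phi>\<close> is
  known only after the colouring, whereas marked vertices have to be fixed before. On vertices
  outside the copies of \<open>W\<close> its values are arbitrary.
\<close>

definition supplies_neighbourhoods ::
  "nat \<Rightarrow> 'h pair_pre_digraph \<Rightarrow> nat pair_pre_digraph \<Rightarrow> nat set set \<Rightarrow> nat pair_pre_digraph
     \<Rightarrow> (nat \<Rightarrow> nat) \<Rightarrow> bool" where
  "supplies_neighbourhoods k H W \<S> X r \<longleftrightarrow>
     (\<forall>p. connected_colouring X p \<longrightarrow> mono_clique k X p \<or> (\<exists>f. quotient_copy H X p f) \<or>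
       (\<exists>\<phi>. induced_embedding \<phi> W X \<and> saturated p \<phi> W X \<and> (\<forall>w\<in>pverts W. r (\<phi> w) = w) \<and>
          (\<forall>S\<in>\<S>. \<exists>q\<in>p ` pverts X - p ` \<phi> ` pverts W.
             \<forall>w\<in>pverts W. colour_adj X p q (p (\<phi> w)) \<longleftrightarrow> p (\<phi> w) \<in> p ` \<phi> ` S)))"

lemma supplies_neighbourhoodsE:
  assumes "supplies_neighbourhoods k H W \<S> X r" "connected_colouring X p"
  obtains (clique) "mono_clique k X p"
    | (quotient) f where "quotient_copy H X p f"
    | (copy) \<phi> where "induced_embedding \<phi> W X" "saturated p \<phi> W X" "\<forall>w\<in>pverts W. r (\<phi> w) = w"
        "\<forall>S\<in>\<S>. \<exists>q\<in>p ` pverts X - p ` \<phi> ` pverts W.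
           \<forall>w\<in>pverts W. colour_adj X p q (p (\<phi> w)) \<longleftrightarrow> p (\<phi> w) \<in> p ` \<phi> ` S"
  using mp[OF spec[OF assms(1)[unfolded supplies_neighbourhoods_def]] assms(2)]
  by (elim disjE exE conjE) (rule that; assumption)+

text \<open>
  One round of the iteration. Suppose that there is neither a monochromatic \<open>K\<^bsub>k+1\<^esub>\<close> nor a copy of
  \<open>H\<close> in the quotient. Then \<open>F\<close> contains a monochromatic \<open>k\<close>-clique, and the copy of \<open>X\<close> attached to it
  contains the desired copy of \<open>W\<close>: the colours for the members of \<open>\<S>\<close> are found inside that copy of
  \<open>X\<close>, while the colour of the clique serves the new set \<open>S\<close>.
\<close>

lemma supplies_neighbourhoods_insert:
  fixes H :: "'h pair_pre_digraph" and F :: "nat pair_pre_digraph"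
  assumes k: "1 \<le> k" and hF: "pair_graph F" "unavoidable k H F"
    and hX: "pair_graph X" "supplies_neighbourhoods (Suc k) H W \<S> X r"
    and S: "S \<subseteq> pverts W"
  obtains X' r' where "pair_graph X'" "supplies_neighbourhoods (Suc k) H W (insert S \<S>) X' r'"
proof -
  \<comment> \<open>Vertices of \<open>X\<close> outside the relevant copy of \<open>W\<close> may be marked too; adjacency is only asserted
      for classes inside that copy.\<close>
  define M where "M = {x \<in> pverts X. r x \<in> S}"
  \<comment> \<open>The copies are indexed by the codes of all \<open>k\<close>-cliques of \<open>F\<close>.\<close>
  define I where "I = {i. set_decode i \<subseteq> pverts F \<and> complete_on (parcs F) (set_decode i)
    \<and> card (set_decode i) = k}"
  have finF: "finite (pverts F)"
    using hF(1) by (rule finite_pverts)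
  have "I \<subseteq> set_encode ` Pow (pverts F)"
    by (auto simp: I_def intro!: image_eqI[of _ _ "set_decode _"])
  then have "finite I" using finF by (meson finite_Pow_iff finite_imageI finite_subset)
  then interpret clique_attachment F X M I set_decode
    by (intro clique_attachment.intro hF(1) hX(1)) (auto simp: I_def M_def)
  define r' where "r' v = r (snd (prod_decode v))" for v
  have r': "r' (copy i x) = r x" for i x by (simp add: r'_def copy_def)
  have "supplies_neighbourhoods (Suc k) H W (insert S \<S>) Y r'"
    unfolding supplies_neighbourhoods_def
  proof (intro allI impI, goal_cases)
    case p: (1 p)
    note F_copy = quotient_copy_embedding[OF hF(1) base_embedding base_colour_adj[OF p]]
    consider "mono_clique (Suc k) Y p" | f where "quotient_copy H F (p \<circ> base) f"
      | "\<not> mono_clique (Suc k) Y p" "mono_clique k F (p \<circ> base)"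
      using hF(2) base_connected[OF p] unfolding unavoidable_def by blast
    then show ?case
    proof cases
      case 1
      then show ?thesis by (rule disjI1)
    next
      case 2
      then show ?thesis using F_copy by blast
    next
      case 3
      then obtain C q where C: "C \<subseteq> pverts F" "complete_on (parcs F) C" "card C = k"
        "\<forall>u\<in>C. p (base u) = q"
        by (auto simp: mono_clique_def)
      define i where "i = set_encode C"
      have dec: "set_decode i = C" using C(1) finF by (simp add: i_def finite_subset)
      then have i: "i \<in> I" using C by (simp add: I_def)
      have ctx: "i \<in> I" "set_decode i \<noteq> {}" "\<forall>f\<in>set_decode i. p (base f) = q"
        "\<not> mono_clique (Suc (card (set_decode i))) Y p"
        using i dec C 3 k by auto
      note avoid = copy_avoids_colour[OF p ctx] and sat = copy_saturated[OF p ctx]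
        and adj_iff = clique_colour_adj_iff[OF p ctx]
      note emb = copy_embedding[OF i]
      have adj: "colour_adj Y p a b \<Longrightarrow> colour_adj X (p \<circ> copy i) a b"
        if "a \<in> p ` copy i ` pverts X" "b \<in> p ` copy i ` pverts X" for a b
        using saturated_colour_adj[OF pair_graph_Y emb sat that] .
      have "connected_colouring X (p \<circ> copy i)"
        using emb sat p by (rule saturated_connected_colouring)
      from hX(2) this show ?thesis
      proof (cases rule: supplies_neighbourhoodsE)
        case clique
        then show ?thesis using mono_clique_embedding[OF emb] by blast
      next
        case (quotient f)
        then show ?thesis using quotient_copy_embedding[OF hX(1) emb adj] by blast
      next
        case copy: (copy \<phi>)
        let ?\<psi> = "copy i \<circ> \<phi>"
        have \<phi>X: "\<phi> w \<in> pverts X" if "w \<in> pverts W" for w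
          using copy(1) that by (auto simp: induced_embedding_def)
        have new: "\<exists>q\<in>p ` pverts Y - p ` ?\<psi> ` pverts W.
            \<forall>w\<in>pverts W. colour_adj Y p q (p (?\<psi> w)) \<longleftrightarrow> p (?\<psi> w) \<in> p ` ?\<psi> ` S"
        proof (intro bexI ballI)
          obtain f where f: "f \<in> C" using C(3) k by fastforce
          then have "base f \<in> pverts Y" using C(1) by auto
          then have "q \<in> p ` pverts Y" using f C(4) by (metis image_eqI)
          moreover have "q \<noteq> p (?\<psi> w)" if "w \<in> pverts W" for w
            using avoid[OF \<phi>X[OF that]] by simp
          ultimately show "q \<in> p ` pverts Y - p ` ?\<psi> ` pverts W" by blast
          fix w assume w: "w \<in> pverts W"
          have "(\<exists>y\<in>M. p (copy i y) = p (copy i (\<phi> w))) \<longleftrightarrow> (\<exists>s\<in>S. p (copy i (\<phi> s)) = p (copy i (\<phi> w)))"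
          proof
            assume "\<exists>y\<in>M. p (copy i y) = p (copy i (\<phi> w))"
            then obtain y where y: "y \<in> M" "p (copy i y) = p (copy i (\<phi> w))" by auto
            then have "y \<in> \<phi> ` pverts W"
              using copy(2) w unfolding saturated_def M_def by (auto simp: image_iff)
            then show "\<exists>s\<in>S. p (copy i (\<phi> s)) = p (copy i (\<phi> w))"
              using y copy(3) by (auto simp: M_def)
          next
            assume "\<exists>s\<in>S. p (copy i (\<phi> s)) = p (copy i (\<phi> w))"
            then obtain s where "s \<in> S" "p (copy i (\<phi> s)) = p (copy i (\<phi> w))" by auto
            moreover have "\<phi> s \<in> M" using calculation S \<phi>X copy(3) by (auto simp: M_def)
            ultimately show "\<exists>y\<in>M. p (copy i y) = p (copy i (\<phi> w))" by auto
          qed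
          then show "colour_adj Y p q (p (?\<psi> w)) \<longleftrightarrow> p (?\<psi> w) \<in> p ` ?\<psi> ` S"
            using adj_iff[OF \<phi>X[OF w]] by (auto simp: image_iff eq_commute)
        qed
        have old: "\<exists>q\<in>p ` pverts Y - p ` ?\<psi> ` pverts W.
            \<forall>w\<in>pverts W. colour_adj Y p q (p (?\<psi> w)) \<longleftrightarrow> p (?\<psi> w) \<in> p ` ?\<psi> ` T" if T: "T \<in> \<S>" for T
        proof -
          have q\<psi>: "(p \<circ> copy i) ` \<phi> ` A = p ` ?\<psi> ` A" "(p \<circ> copy i) (\<phi> w) = p (?\<psi> w)"
            "(p \<circ> copy i) ` pverts X = p ` copy i ` pverts X" for A w
            by (simp_all add: image_comp o_assoc)
          from bspec[OF copy(4) T] obtain q' where "q' \<in> p ` copy i ` pverts X - p ` ?\<psi> ` pverts W"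
            "\<forall>w\<in>pverts W. colour_adj X (p \<circ> copy i) q' (p (?\<psi> w)) \<longleftrightarrow> p (?\<psi> w) \<in> p ` ?\<psi> ` T"
            unfolding q\<psi> by (rule bexE)
          then have q': "q' \<in> p ` copy i ` pverts X" "q' \<notin> p ` ?\<psi> ` pverts W"
            "\<forall>w\<in>pverts W. colour_adj X (p \<circ> copy i) q' (p (?\<psi> w)) \<longleftrightarrow> p (?\<psi> w) \<in> p ` ?\<psi> ` T"
            by simp_all
          show ?thesis
          proof (intro bexI[of _ q'] ballI DiffI q'(2))
            show "q' \<in> p ` pverts Y" using q'(1) i by auto
            fix w assume w: "w \<in> pverts W"
            have "colour_adj Y p q' (p (?\<psi> w)) \<longleftrightarrow> colour_adj X (p \<circ> copy i) q' (p (?\<psi> w))"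
              using adj[OF q'(1)] colour_adj_embedding[OF hX(1) emb] \<phi>X[OF w] by auto
            then show "colour_adj Y p q' (p (?\<psi> w)) \<longleftrightarrow> p (?\<psi> w) \<in> p ` ?\<psi> ` T"
              using bspec[OF q'(3) w] by simp
          qed
        qed
        have "induced_embedding ?\<psi> W Y" using copy(1) emb by (rule induced_embedding_comp)
        moreover have "saturated p ?\<psi> W Y" using copy(1,2) sat by (rule saturated_comp)
        moreover have "\<forall>w\<in>pverts W. r' (?\<psi> w) = w" using copy(3) r' by simp
        moreover have "\<forall>S'\<in>insert S \<S>. \<exists>q\<in>p ` pverts Y - p ` ?\<psi> ` pverts W.
            \<forall>w\<in>pverts W. colour_adj Y p q (p (?\<psi> w)) \<longleftrightarrow> p (?\<psi> w) \<in> p ` ?\<psi> ` S'"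
          unfolding ball_simps(7) using new old by (intro conjI ballI)
        ultimately show ?thesis by (intro disjI2 exI[of _ ?\<psi>] conjI)
      qed
    qed
  qed
  with pair_graph_Y show thesis by (rule that)
qed

lemma supplies_neighbourhoods_exists:
  fixes H :: "'h pair_pre_digraph" and F :: "nat pair_pre_digraph"
  assumes "1 \<le> k" "pair_graph F" "unavoidable k H F" "pair_graph W"
    and "finite \<S>" "\<S> \<subseteq> Pow (pverts W)"
  shows "\<exists>X r. pair_graph X \<and> supplies_neighbourhoods (Suc k) H W \<S> X r"
  using assms(5,6)
proof (induction \<S> rule: finite_induct)
  case empty
  have "induced_embedding id W W" by (simp add: induced_embedding_def)
  moreover have "saturated p id W W" for p by (simp add: saturated_def)
  ultimately have "supplies_neighbourhoods (Suc k) H W {} W id"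
    unfolding supplies_neighbourhoods_def by (intro allI impI disjI2 exI[of _ id] conjI) simp_all
  then show ?case using assms(4) by blast
next
  case (insert S \<S>)
  then obtain X r where X: "pair_graph X" "supplies_neighbourhoods (Suc k) H W \<S> X r" by auto
  have "S \<subseteq> pverts W" using insert.prems by auto
  then obtain X' r' where "pair_graph X'" "supplies_neighbourhoods (Suc k) H W (insert S \<S>) X' r'"
    by (rule supplies_neighbourhoods_insert[OF assms(1-3) X])
  then show ?case by blast
qed

section \<open>Existence of unavoidable graphs\<close>

text \<open>
  The copy of \<open>W\<close> provides \<open>H - v\<close> in the quotient. The colour for \<open>v\<close> is the one supplied for the
  union of the classes that represent neighbours of \<open>v\<close>.
\<close>

lemma unavoidable_add_vertex:
  fixes H H' :: "'h pair_pre_digraph"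
  assumes H: "pair_graph H" and v: "v \<in> pverts H"
    and H': "pverts H' = pverts H - {v}" "parcs H' = parcs H \<inter> (pverts H' \<times> pverts H')"
    and W: "pair_graph W" "unavoidable k H' W"
    and X: "pair_graph X" "supplies_neighbourhoods k H W (Pow (pverts W)) X r"
  shows "unavoidable k H X"
  unfolding unavoidable_def
proof (intro allI impI)
  fix p assume p: "connected_colouring X p"
  from X(2) p show "mono_clique k X p \<or> (\<exists>f. quotient_copy H X p f)"
  proof (cases rule: supplies_neighbourhoodsE)
    case clique
    then show ?thesis by (rule disjI1)
  next
    case quotient
    then show ?thesis by blast
  next
    case copy: (copy \<phi>)
    have "connected_colouring W (p \<circ> \<phi>)"
      using copy(1,2) p by (rule saturated_connected_colouring)
    with W(2) consider "mono_clique k W (p \<circ> \<phi>)" | f where "quotient_copy H' W (p \<circ> \<phi>) f"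
      unfolding unavoidable_def by blast
    then show ?thesis
    proof cases
      case 1
      then show ?thesis using mono_clique_embedding[OF copy(1)] by blast
    next
      case (2 f)
      have "quotient_copy H' X p f"
        using W(1) copy(1) saturated_colour_adj[OF X(1) copy(1,2)] 2 by (rule quotient_copy_embedding)
      then have f: "inj_on f (pverts H')" "f ` pverts H' \<subseteq> p ` pverts X"
        "\<And>x y. x \<in> pverts H' \<Longrightarrow> y \<in> pverts H' \<Longrightarrow> (x, y) \<in> parcs H' \<longleftrightarrow> colour_adj X p (f x) (f y)"
        by (auto simp: quotient_copy_def)
      have fW: "f ` pverts H' \<subseteq> p ` \<phi> ` pverts W"
        using 2 by (simp add: quotient_copy_def image_comp)
      define N where "N = {x \<in> pverts H'. (v, x) \<in> parcs H}"
      define S where "S = {w \<in> pverts W. p (\<phi> w) \<in> f ` N}"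
      have "S \<in> Pow (pverts W)" by (auto simp: S_def)
      from bspec[OF copy(4) this] obtain q where "q \<in> p ` pverts X - p ` \<phi> ` pverts W"
        and q_iff: "\<forall>w\<in>pverts W. colour_adj X p q (p (\<phi> w)) \<longleftrightarrow> p (\<phi> w) \<in> p ` \<phi> ` S"
        by (rule bexE)
      then have q: "q \<in> p ` pverts X" "q \<notin> p ` \<phi> ` pverts W" by simp_all
      have q_adj: "colour_adj X p q (f x) \<longleftrightarrow> (v, x) \<in> parcs H" if x: "x \<in> pverts H'" for x
      proof -
        obtain w where w: "w \<in> pverts W" "f x = p (\<phi> w)" using fW x by auto
        have "f x \<in> p ` \<phi> ` S \<longleftrightarrow> f x \<in> f ` N"
          using w by (auto simp: S_def)
        also have "\<dots> \<longleftrightarrow> x \<in> N"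
          using f(1) x by (auto simp: N_def inj_on_def)
        finally show ?thesis using bspec[OF q_iff w(1)] w(2) x by (simp add: N_def)
      qed
      define g where "g = f(v := q)"
      have g: "g v = q" "\<And>x. x \<in> pverts H' \<Longrightarrow> g x = f x" using H'(1) by (auto simp: g_def)
      have VH: "pverts H = insert v (pverts H')" using H'(1) v by auto
      have "inj_on g (pverts H)"
      proof -
        have "inj_on g (pverts H')" using f(1) g(2) by (simp add: inj_on_def)
        moreover have "g v \<notin> g ` pverts H'" using g fW q(2) by auto
        ultimately show ?thesis unfolding VH inj_on_insert by blast
      qed
      moreover have "g ` pverts H \<subseteq> p ` pverts X" unfolding VH using g q(1) f(2) by auto
      moreover have "(x, y) \<in> parcs H \<longleftrightarrow> colour_adj X p (g x) (g y)"
        if xy: "x \<in> pverts H" "y \<in> pverts H" for x y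
      proof -
        have sym: "(x, y) \<in> parcs H \<longleftrightarrow> (y, x) \<in> parcs H" for x y
          using pair_graph_arcs(4)[OF H] by blast
        have irr: "(v, v) \<notin> parcs H" using pair_graph_arcs(3)[OF H] by blast
        have H'_arc: "(x, y) \<in> parcs H' \<longleftrightarrow> (x, y) \<in> parcs H" if "x \<in> pverts H'" "y \<in> pverts H'"
          using H'(2) that by auto
        consider "x = v" "y = v" | "x = v" "y \<in> pverts H'" | "x \<in> pverts H'" "y = v"
          | "x \<in> pverts H'" "y \<in> pverts H'"
          using xy unfolding VH by blast
        then show ?thesis
        proof cases
          case 1
          then show ?thesis using irr by (simp add: colour_adj_def)
        next
          case 2
          then show ?thesis using q_adj g by simp
        next
          case 3
          then show ?thesis using q_adj[of x] g sym[of x v] colour_adj_sym[OF X(1), of p "f x" q] by simp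
        next
          case 4
          then show ?thesis using H'_arc f(3) g(2) by simp
        qed
      qed
      ultimately show ?thesis unfolding quotient_copy_def by blast
    qed
  qed
qed

text \<open>
  The double induction. In the induction step on \<open>k\<close> the hypothesis is used for \<open>H\<close> itself, to get the
  monochromatic \<open>k\<close>-cliques; the induction on \<open>H\<close> provides the graph for \<open>H - v\<close> and \<open>k + 1\<close>.
\<close>

lemma unavoidable_exists:
  fixes H :: "'h pair_pre_digraph"
  assumes "1 \<le> k" "pair_graph H"
  shows "\<exists>G :: nat pair_pre_digraph. pair_graph G \<and> unavoidable k H G"
  using assms
proof (induction k arbitrary: H rule: nat_induct_at_least)
  case base
  let ?G = "\<lparr> pverts = {0}, parcs = {} \<rparr> :: nat pair_pre_digraph"
  have "pair_graph ?G" by (rule pair_graphI) auto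
  moreover have "mono_clique 1 ?G p" for p
    unfolding mono_clique_def by (intro exI[of _ "{0}"]) (auto simp: complete_on_def)
  ultimately show ?case unfolding unavoidable_def by blast
next
  case (Suc k)
  have "finite (pverts H)"
    using Suc.prems by (rule finite_pverts)
  then show ?case using Suc.prems
  proof (induction "pverts H" arbitrary: H rule: finite_psubset_induct)
    case (psubset H)
    show ?case
    proof (cases "pverts H = {}")
      case True
      let ?G = "\<lparr> pverts = {}, parcs = {} \<rparr> :: nat pair_pre_digraph"
      have "pair_graph ?G" by (rule pair_graphI) auto
      moreover have "unavoidable (Suc k) H ?G"
        using True by (simp add: unavoidable_def quotient_copy_def)
      ultimately show ?thesis by blast
    next
      case False
      then obtain v where v: "v \<in> pverts H" by auto
      define V where "V = pverts H - {v}"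
      define H' where "H' = \<lparr> pverts = V, parcs = parcs H \<inter> (V \<times> V) \<rparr>"
      have H': "pverts H' = pverts H - {v}" "parcs H' = parcs H \<inter> (pverts H' \<times> pverts H')"
        by (simp_all add: H'_def V_def)
      have "pair_graph H'"
        by (rule pair_graphI)
          (use psubset.hyps pair_graph_arcs[OF psubset.prems] H' in auto)
      moreover have "pverts H' \<subset> pverts H" using H' v by auto
      ultimately obtain W :: "nat pair_pre_digraph"
        where W: "pair_graph W" "unavoidable (Suc k) H' W"
        using psubset.hyps(2) by blast
      obtain F :: "nat pair_pre_digraph" where F: "pair_graph F" "unavoidable k H F"
        using Suc.IH[OF psubset.prems] by blast
      have "finite (Pow (pverts W))"
        using W(1) by (meson finite_Pow_iff finite_pverts)
      then obtain X r where X: "pair_graph X"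
        "supplies_neighbourhoods (Suc k) H W (Pow (pverts W)) X r"
        using supplies_neighbourhoods_exists[OF Suc.hyps F W(1)] by blast
      then show ?thesis using unavoidable_add_vertex[OF psubset.prems v H' W] by blast
    qed
  qed
qed

section \<open>From partitions to colourings\<close>

lemma connected_imp_connected_in:
  assumes "connected (with_proj Q)" "pair_graph Q"
  shows "connected_in (parcs Q) (pverts Q)"
  unfolding connected_in_def
proof (intro allI impI, elim conjE, rule ccontr)
  fix B assume B: "B \<noteq> {}" "B \<subset> pverts Q" and no: "\<not> (\<exists>u\<in>B. \<exists>v\<in>pverts Q - B. (u, v) \<in> parcs Q)"
  interpret pair_graph Q by fact
  obtain u v where uv: "u \<in> B" "v \<in> pverts Q" "v \<notin> B" using B by auto
  have "strongly_connected (with_proj Q)"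
    using symmetric_connected_imp_strongly_connected[OF sym_arcs assms(1)] .
  then have "u \<rightarrow>\<^sup>*\<^bsub>with_proj Q\<^esub> v"
    using uv B by (auto simp: strongly_connected_def)
  then have "v \<in> B"
  proof (induction rule: reachable_induct)
    case base
    show ?case by (rule uv(1))
  next
    case (step x y)
    have xy: "(x, y) \<in> parcs Q" using step.hyps(2) by simp
    then show ?case using no step.IH pair_graph_arcs(2)[OF assms(2) xy] by blast
  qed
  then show False using uv(3) by simp
qed

lemma induced_pair_graph:
  assumes "pair_graph G" "induced_subgraph (with_proj Q) (with_proj G)"
  shows "pair_graph Q"
proof (rule pair_graphI)
  have Q: "pverts Q \<subseteq> pverts G" "parcs Q = parcs G \<inter> pverts Q \<times> pverts Q"
    using assms(2) by (simp_all add: induced_subgraph_pair_iff[OF assms(1)])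
  show "finite (pverts Q)"
    using Q(1) assms(1) by (meson finite_subset finite_pverts)
  show "u \<in> pverts Q \<and> v \<in> pverts Q \<and> u \<noteq> v" if "(u, v) \<in> parcs Q" for u v
    using that pair_graph_arcs[OF assms(1)] Q(2) by auto
  show "(v, u) \<in> parcs Q" if "(u, v) \<in> parcs Q" for u v
    using that pair_graph_arcs[OF assms(1)] Q(2) by auto
qed

lemma contains_graphI:
  assumes G: "pair_graph G" and H: "pair_graph H" and f: "induced_embedding f H G"
  shows "contains_graph G H"
proof -
  define S where "S = \<lparr> pverts = f ` pverts H, parcs = map_prod f f ` parcs H \<rparr>"
  have "parcs S = parcs G \<inter> pverts S \<times> pverts S"
    using f pair_graph_arcs(1,2)[OF H] by (force simp: S_def induced_embedding_def)
  then have "induced_subgraph (with_proj S) (with_proj G)"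
    using f by (simp add: induced_subgraph_pair_iff[OF G] S_def induced_embedding_def)
  moreover have "digraph_iso (with_proj H) (with_proj S)"
    using f by (auto simp: digraph_iso_pair_iff[OF H] S_def induced_embedding_def)
  ultimately show ?thesis unfolding contains_graph_def by blast
qed

lemma complete_on_contains_complete_graph:
  assumes G: "pair_graph G" and C: "C \<subseteq> pverts G" "complete_on (parcs G) C" "card C = k"
  shows "contains_graph G (complete_graph k)"
proof -
  have K: "pair_graph (complete_graph k)" by (rule pair_graphI) (auto simp: complete_graph_def)
  have "finite C"
    using C(1) G by (meson finite_subset finite_pverts)
  then obtain h where h: "bij_betw h {..<k} C"
    using C(3) ex_bij_betw_nat_finite atLeast0LessThan by metis
  have "(h i, h j) \<in> parcs G \<longleftrightarrow> i \<noteq> j" if "i < k" "j < k" for i j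
  proof -
    have "h i \<in> C" "h j \<in> C" "h i = h j \<longleftrightarrow> i = j"
      using h that by (auto simp: bij_betw_def inj_on_def)
    then show ?thesis using C(2) pair_graph_arcs(3)[OF G] by (metis complete_on_def)
  qed
  then have "induced_embedding h (complete_graph k) G"
    using h C(1) by (auto simp: induced_embedding_def complete_graph_def bij_betw_def)
  then show ?thesis by (rule contains_graphI[OF G K])
qed

lemma unavoidable_connected_graph_partition:
  assumes G: "pair_graph G" and H: "pair_graph H" and k: "1 \<le> k" and un: "unavoidable k H G"
    and P: "connected_graph_partition G \<P>"
  shows "(\<exists>Q\<in>\<P>. contains_graph Q (complete_graph k)) \<or> contains_graph (quotient_graph G \<P>) H"
proof -
  have part: "graph_partition G \<P>" and conn: "\<And>Q. Q \<in> \<P> \<Longrightarrow> connected (with_proj Q)"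
    using P by (auto simp: connected_graph_partition_def)
  have ind: "pverts Q \<subseteq> pverts G" "parcs Q = parcs G \<inter> pverts Q \<times> pverts Q"
      "pverts Q \<noteq> {}" "pair_graph Q" if "Q \<in> \<P>" for Q
    using that part induced_pair_graph[OF G]
    by (auto simp: graph_partition_def induced_subgraph_pair_iff[OF G])
  have ex1: "\<exists>!Q. Q \<in> \<P> \<and> v \<in> pverts Q" if "v \<in> pverts G" for v
    using part that by (auto simp: graph_partition_def)
  note quot = pair_graph_quotient_graph[OF G part]
  have "finite \<P>"
    using finite_pverts[OF quot] by (simp add: quotient_graph_def)
  \<comment> \<open>Number the parts and give each vertex the number of its part.\<close>
  then obtain g :: "_ \<Rightarrow> nat" where g: "inj_on g \<P>" using finite_imp_inj_to_nat_seg by metis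
  define p where "p v = g (THE Q. Q \<in> \<P> \<and> v \<in> pverts Q)" for v
  have p: "p v = g Q" if "Q \<in> \<P>" "v \<in> pverts Q" for v Q
  proof -
    have "v \<in> pverts G" using that ind(1) by auto
    then have "(THE Q. Q \<in> \<P> \<and> v \<in> pverts Q) = Q"
      using that by (intro the1_equality[OF ex1]) auto
    then show ?thesis by (simp add: p_def)
  qed
  have pE: "\<exists>Q\<in>\<P>. v \<in> pverts Q \<and> p v = g Q" if "v \<in> pverts G" for v
    using ex1[OF that] p by blast
  have fib: "v \<in> pverts Q \<longleftrightarrow> p v = g Q" if "Q \<in> \<P>" "v \<in> pverts G" for v Q
    using that p pE g by (metis inj_onD)
  have "connected_colouring G p"
    unfolding connected_colouring_def
  proof
    fix q
    show "connected_in (parcs G) {v \<in> pverts G. p v = q}"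
    proof (cases "q \<in> g ` \<P>")
      case True
      then obtain Q where Q: "Q \<in> \<P>" "q = g Q" by auto
      then have "{v \<in> pverts G. p v = q} = pverts Q" using fib ind(1) by blast
      moreover have "connected_in (parcs Q) (pverts Q)"
        using connected_imp_connected_in conn ind(4) Q(1) by blast
      ultimately show ?thesis using ind(2)[OF Q(1)] connected_in_mono by (metis inf_le1)
    next
      case False
      then have "{v \<in> pverts G. p v = q} = {}" using pE by blast
      then show ?thesis by (simp only: connected_in_def) blast
    qed
  qed
  then consider "mono_clique k G p" | f where "quotient_copy H G p f"
    using un unfolding unavoidable_def by blast
  then show ?thesis
  proof cases
    case 1
    then obtain C q where C: "C \<subseteq> pverts G" "complete_on (parcs G) C" "card C = k" "\<forall>u\<in>C. p u = q"
      by (auto simp: mono_clique_def)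
    then have "C \<noteq> {}" using k by auto
    then obtain u where u: "u \<in> C" by blast
    then obtain Q where Q: "Q \<in> \<P>" "p u = g Q" using pE C(1) by blast
    then have "C \<subseteq> pverts Q" using C(1,4) u fib[OF Q(1)] by auto
    moreover have "complete_on (parcs Q) C"
      using calculation C(2) ind(2)[OF Q(1)] by (auto simp: complete_on_def)
    ultimately show ?thesis using complete_on_contains_complete_graph ind(4) Q C(3) by blast
  next
    case (2 f)
    have col: "p ` pverts G \<subseteq> g ` \<P>" using pE by auto
    define h where "h = inv_into \<P> g \<circ> f"
    have f: "inj_on f (pverts H)" "f ` pverts H \<subseteq> g ` \<P>"
      "\<forall>x\<in>pverts H. \<forall>y\<in>pverts H. (x, y) \<in> parcs H \<longleftrightarrow> colour_adj G p (f x) (f y)"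
      using 2 subset_trans[OF _ col] by (simp_all add: quotient_copy_def)
    have h: "h x \<in> \<P>" "g (h x) = f x" if "x \<in> pverts H" for x
    proof -
      have "f x \<in> g ` \<P>" using f(2) that by auto
      then show "h x \<in> \<P>" "g (h x) = f x"
        unfolding h_def comp_def by (rule inv_into_into, rule f_inv_into_f)
    qed
    have "inj_on h (pverts H)"
    proof (rule inj_onI)
      fix x y assume xy: "x \<in> pverts H" "y \<in> pverts H" "h x = h y"
      then have "f x = f y" using h(2)[OF xy(1)] h(2)[OF xy(2)] by simp
      then show "x = y" using f(1) xy by (simp add: inj_on_eq_iff)
    qed
    moreover have adj: "(A, B) \<in> parcs (quotient_graph G \<P>) \<longleftrightarrow> colour_adj G p (g A) (g B)"
      if "A \<in> \<P>" "B \<in> \<P>" for A B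
    proof -
      have "A \<noteq> B \<longleftrightarrow> g A \<noteq> g B" using g that by (metis inj_onD)
      moreover have "(\<exists>u\<in>pverts A. \<exists>v\<in>pverts B. (u, v) \<in> parcs G)
          \<longleftrightarrow> (\<exists>(u, v)\<in>parcs G. p u = g A \<and> p v = g B)"
        using fib[OF that(1)] fib[OF that(2)] pair_graph_arcs(1,2)[OF G] by fast
      ultimately show ?thesis using that by (simp add: quotient_graph_def colour_adj_def)
    qed
    ultimately have "induced_embedding h H (quotient_graph G \<P>)"
      using f(3) h by (auto simp: induced_embedding_def) (auto simp: quotient_graph_def)
    then show ?thesis using contains_graphI[OF quot H] by blast
  qed
qed

theorem theorem4:
  fixes k :: nat and H :: "'a pair_pre_digraph"
  assumes "1 \<le> k" and "pair_graph H"
  shows "\<exists>G :: nat pair_pre_digraph. pair_graph G \<and>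
    (\<forall>\<P>. connected_graph_partition G \<P> \<longrightarrow>
      (\<exists>Q\<in>\<P>. contains_graph Q (complete_graph k)) \<or>
      contains_graph (quotient_graph G \<P>) H)"
  using unavoidable_exists[OF assms] unavoidable_connected_graph_partition[OF _ assms(2,1)] by blast

end
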